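(* Every exponential family, with natural parameter space $\Theta\subseteq\mathbb{R}^n$ and log-partition function $\Psi$, carries a natural Legendre bundle structure over $\Theta$, with $H^+=T\Theta$, $H^-=T^*\Theta$, flat connections $\nabla^+$ and $\nabla^-$ induced by the affine structures on $\Theta$ and $\Theta^*$ respectively (where $\Theta^*=d\Psi(\Theta)$), and potential $\Psi$ given by the log-partition function.
   Context: Exponential family: let $(\Omega,\Sigma)$ be a measurable space with a $\sigma$-finite positive measure $\mu$ and let $T:\Omega\to\mathbb{R}^n$ be a measurable map (the sufficient statistic). Set $\Psi(\theta)=\log\int_\Omega\exp(\langle\theta,T(\omega)\rangle)\,\mu(d\omega)$ and $\Theta=\{\theta\in\mathbb{R}^n:\Psi(\theta)<\infty\}$. The family consists of the probability measures $P_\theta$, $\theta\in\Theta$, with densities $\rho_\theta(\omega)=\exp(\langle\theta,T(\omega)\rangle-\Psi(\theta))$ with respect to $\mu$. Standing assumptions: $\Theta$ is an open convex subset of $\mathbb{R}^n$, and $\Psi$ is smooth and strictly convex on $\Theta$, in the sense that its Hessian $g_{ij}=\partial_i\partial_j\Psi$ is positive definite (it is the Fisher–Rao metric). Connections: $\theta=(\theta^1,\dots,\theta^n)$ are the standard linear coordinates; $\nabla^+$ is the connection on $T\Theta$ for which the coordinate fields $\partial_i$ are parallel. The dual coordinates are $\eta_i=\partial_i\Psi(\theta)$, identifying $\Theta$ with $\Theta^*=d\Psi(\Theta)\subseteq(\mathbb{R}^n)^*$; they define the flat connection on $T\Theta$ for which the $\partial/\partial\eta_i$ are parallel, characterized by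 duality to $\nabla^+$: $Z\,g(X,Y)=g(\nabla^+_ZX,Y)+g(X,\nabla^-_ZY)$. It is viewed as the connection $\nabla^-$ on $T^*\Theta$ via the isomorphism $T\Theta\to T^*\Theta$, $Y\mapsto g(Y,\cdot)$. Legendre bundle over a smooth manifold $B$: a quintuple $(H,\langle\!\langle\cdot,\cdot\rangle\!\rangle,\nabla^+,\nabla^-,\Psi)$ where: (1) $H=H^+\oplus H^-$ is a vector bundle over $B$ with isomorphisms $H^+\cong TB$, $H^-\cong T^*B$; (2) $\langle\!\langle\cdot,\cdot\rangle\!\rangle$ is a non-degenerate symmetric bilinear form on $H$ vanishing on $H^+\otimes H^+$ and on $H^-\otimes H^-$, with $\langle\!\langle X,\alpha\rangle\!\rangle=\alpha(X)$ for $X\in H^+$, $\alpha\in H^-$; (3) $\nabla^+$ and $\nabla^-$ are flat connections on $H^+$ and $H^-$ satisfying $Z\langle\!\langle X,\alpha\rangle\!\rangle=\langle\!\langle\nabla^+_ZX,\alpha\rangle\!\rangle+\langle\!\langle X,\nabla^-_Z\alpha\rangle\!\rangle$ for all sections $X$ of $H^+$, $\alpha$ of $H^-$ and all vector fields $Z$ on $B$; here $\nabla^+$, viewed on $TB$, is torsion-free, so that local $\nabla^+$-flat coordinates $(\theta^i)$ (with $\partial_i$ parallel) exist; (4) $\Psi\in C^\infty(B)$ is strictly convex with respect to the flat structure of $\nabla^+$ (positive-definite Hessian in $\nabla^+$-flat coordinates), with associated Legendre morphism $\mathscr{L}_\Psi:H^+\to H^-$, $\mathscr{L}_\Psi(\partial_j)=\sum_i(\partial_i\partial_j\Psi)\,d\theta^i$.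 *)

theory Defs
  imports "HOL-Analysis.Analysis"
begin

section \<open>Smooth maps between open subsets of normed spaces\<close>

text \<open>
  Only used for open \<open>S\<close> in a finite-dimensional space, where existence and continuity of all
  iterated directional derivatives up to order \<open>k\<close> is the usual notion of class \<open>C\<^sup>k\<close>.
\<close>

primrec Ck_on :: "nat \<Rightarrow> 'a::euclidean_space set \<Rightarrow> ('a \<Rightarrow> 'b::real_normed_vector) \<Rightarrow> bool" where
  "Ck_on 0 S f \<longleftrightarrow> continuous_on S f"
| "Ck_on (Suc k) S f \<longleftrightarrow>
     (\<forall>x\<in>S. f differentiable (at x)) \<and> (\<forall>v. Ck_on k S (\<lambda>x. frechet_derivative f (at x) v))"

definition smooth_on :: "'a::euclidean_space set \<Rightarrow> ('a \<Rightarrow> 'b::real_normed_vector) \<Rightarrow> bool" where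
  "smooth_on S f \<longleftrightarrow> (\<forall>k. Ck_on k S f)"

definition diffeo_onto_open :: "'a::euclidean_space set \<Rightarrow> ('a \<Rightarrow> 'a) \<Rightarrow> bool" where
  "diffeo_onto_open U x \<longleftrightarrow> open U \<and> inj_on x U \<and> open (x ` U) \<and>
     smooth_on U x \<and> smooth_on (x ` U) (the_inv_into U x)"

text \<open>\<open>hessian f p u v\<close> is \<open>\<partial>\<^sub>u \<partial>\<^sub>v f\<close> at \<open>p\<close>; on basis vectors it is the matrix of second partial
  derivatives.\<close>

definition hessian :: "('a::euclidean_space \<Rightarrow> real) \<Rightarrow> 'a \<Rightarrow> 'a \<Rightarrow> 'a \<Rightarrow> real" where
  "hessian f p u v = frechet_derivative (\<lambda>q. frechet_derivative f (at q) v) (at p) u"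

definition pos_def_hessian_on :: "'a::euclidean_space set \<Rightarrow> ('a \<Rightarrow> real) \<Rightarrow> bool" where
  "pos_def_hessian_on S f \<longleftrightarrow> (\<forall>p\<in>S. \<forall>v. v \<noteq> 0 \<longrightarrow> hessian f p v v > 0)"

section \<open>Vector bundles and connections over an open set\<close>

text \<open>
  A bundle over an open set \<open>B\<close> is a smooth family of finite-dimensional subspaces \<open>E p\<close>, \<open>p \<in> B\<close>,
  of a normed space, i.e. a subbundle of a trivial bundle.
  Sections over an open \<open>U \<subseteq> B\<close> are represented by total functions of which only the values on \<open>U\<close>
  matter.
\<close>

definition vector_bundle ::
    "'a::euclidean_space set \<Rightarrow> ('a \<Rightarrow> 'e::real_normed_vector set) \<Rightarrow> bool" where
  "vector_bundle B E \<longleftrightarrow>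
     (\<forall>p\<in>B. \<exists>U (r::nat) e. open U \<and> p \<in> U \<and> U \<subseteq> B \<and> (\<forall>i<r. smooth_on U (e i)) \<and>
        (\<forall>q\<in>U. inj_on (\<lambda>i. e i q) {..<r} \<and> independent ((\<lambda>i. e i q) ` {..<r}) \<and>
                span ((\<lambda>i. e i q) ` {..<r}) = E q))"

definition smooth_section ::
    "'a::euclidean_space set \<Rightarrow> ('a \<Rightarrow> 'e::real_normed_vector set) \<Rightarrow> ('a \<Rightarrow> 'e) \<Rightarrow> bool" where
  "smooth_section U E s \<longleftrightarrow> smooth_on U s \<and> (\<forall>p\<in>U. s p \<in> E p)"

definition bundle_iso ::
    "'a::euclidean_space set \<Rightarrow> ('a \<Rightarrow> 'e::real_normed_vector set) \<Rightarrow>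
     ('a \<Rightarrow> 'f::real_normed_vector set) \<Rightarrow> ('a \<Rightarrow> 'e \<Rightarrow> 'f) \<Rightarrow> bool" where
  "bundle_iso B E F \<phi> \<longleftrightarrow>
     (\<forall>p\<in>B. bij_betw (\<phi> p) (E p) (F p) \<and>
        (\<forall>x\<in>E p. \<forall>y\<in>E p. \<phi> p (x + y) = \<phi> p x + \<phi> p y) \<and>
        (\<forall>c. \<forall>x\<in>E p. \<phi> p (c *\<^sub>R x) = c *\<^sub>R \<phi> p x)) \<and>
     (\<forall>U s. open U \<and> U \<subseteq> B \<and> (\<forall>p\<in>U. s p \<in> E p) \<longrightarrow>
        (smooth_on U (\<lambda>p. \<phi> p (s p)) \<longleftrightarrow> smooth_on U s))"

definition tangent_bundle :: "'a::euclidean_space \<Rightarrow> 'a set" where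
  "tangent_bundle p = UNIV"

definition cotangent_bundle :: "'a::euclidean_space \<Rightarrow> ('a \<Rightarrow>\<^sub>L real) set" where
  "cotangent_bundle p = UNIV"

abbreviation vector_field :: "'a::euclidean_space set \<Rightarrow> ('a \<Rightarrow> 'a) \<Rightarrow> bool" where
  "vector_field U \<equiv> smooth_section U tangent_bundle"

definition lie_bracket :: "('a::euclidean_space \<Rightarrow> 'a) \<Rightarrow> ('a \<Rightarrow> 'a) \<Rightarrow> 'a \<Rightarrow> 'a" where
  "lie_bracket X Y p = frechet_derivative Y (at p) (X p) - frechet_derivative X (at p) (Y p)"

text \<open>
  The conditions range over all open \<open>U \<subseteq> B\<close>, so that a connection also acts on local sections.
  Linearity over functions and the Leibniz rule (applied to functions \<open>f\<close> that vanish on \<open>U\<close>) imply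
  that \<open>D Z s\<close> on \<open>U\<close> depends only on \<open>Z\<close> and \<open>s\<close> on \<open>U\<close>.
\<close>

definition connection ::
    "'a::euclidean_space set \<Rightarrow> ('a \<Rightarrow> 'e::real_normed_vector set) \<Rightarrow>
     (('a \<Rightarrow> 'a) \<Rightarrow> ('a \<Rightarrow> 'e) \<Rightarrow> 'a \<Rightarrow> 'e) \<Rightarrow> bool" where
  "connection B E D \<longleftrightarrow>
     (\<forall>U Z s. open U \<and> U \<subseteq> B \<and> vector_field U Z \<and> smooth_section U E s \<longrightarrow>
        smooth_section U E (D Z s) \<and>
        (\<forall>Z'. vector_field U Z' \<longrightarrow> (\<forall>p\<in>U. D (\<lambda>q. Z q + Z' q) s p = D Z s p + D Z' s p)) \<and>
        (\<forall>f. smooth_on U f \<longrightarrow> (\<forall>p\<in>U. D (\<lambda>q. f q *\<^sub>R Z q) s p = f p *\<^sub>R D Z s p)) \<and>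
        (\<forall>s'. smooth_section U E s' \<longrightarrow>
           (\<forall>p\<in>U. D Z (\<lambda>q. s q + s' q) p = D Z s p + D Z s' p)) \<and>
        (\<forall>f. smooth_on U f \<longrightarrow>
           (\<forall>p\<in>U. D Z (\<lambda>q. f q *\<^sub>R s q) p =
              frechet_derivative f (at p) (Z p) *\<^sub>R s p + f p *\<^sub>R D Z s p)))"

definition flat_connection ::
    "'a::euclidean_space set \<Rightarrow> ('a \<Rightarrow> 'e::real_normed_vector set) \<Rightarrow>
     (('a \<Rightarrow> 'a) \<Rightarrow> ('a \<Rightarrow> 'e) \<Rightarrow> 'a \<Rightarrow> 'e) \<Rightarrow> bool" where
  "flat_connection B E D \<longleftrightarrow> connection B E D \<and>
     (\<forall>U X Y s. open U \<and> U \<subseteq> B \<and> vector_field U X \<and> vector_field U Y \<and> smooth_section U E s \<longrightarrow>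
        (\<forall>p\<in>U. D X (D Y s) p - D Y (D X s) p - D (lie_bracket X Y) s p = 0))"

definition torsion_free ::
    "'a::euclidean_space set \<Rightarrow> (('a \<Rightarrow> 'a) \<Rightarrow> ('a \<Rightarrow> 'a) \<Rightarrow> 'a \<Rightarrow> 'a) \<Rightarrow> bool" where
  "torsion_free B D \<longleftrightarrow>
     (\<forall>U X Y. open U \<and> U \<subseteq> B \<and> vector_field U X \<and> vector_field U Y \<longrightarrow>
        (\<forall>p\<in>U. D X Y p - D Y X p = lie_bracket X Y p))"

text \<open>The connection on a bundle \<open>F\<close> obtained from one on \<open>E\<close> along an isomorphism \<open>\<phi> : E \<rightarrow> F\<close>.\<close>

definition transport_connection ::
    "('a \<Rightarrow> 'e set) \<Rightarrow> ('a \<Rightarrow> 'e \<Rightarrow> 'f) \<Rightarrow> (('a \<Rightarrow> 'a) \<Rightarrow> ('a \<Rightarrow> 'e) \<Rightarrow> 'a \<Rightarrow> 'e) \<Rightarrow>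
     ('a \<Rightarrow> 'a) \<Rightarrow> ('a \<Rightarrow> 'f) \<Rightarrow> 'a \<Rightarrow> 'f" where
  "transport_connection E \<phi> D Z s p = \<phi> p (D Z (\<lambda>q. inv_into (E q) (\<phi> q) (s q)) p)"

section \<open>Connections induced by affine structures\<close>

text \<open>The canonical connection of an open subset of a vector space: constant fields are parallel.\<close>

definition affine_connection ::
    "('v::real_normed_vector \<Rightarrow> 'v) \<Rightarrow> ('v \<Rightarrow> 'v) \<Rightarrow> 'v \<Rightarrow> 'v" where
  "affine_connection Z Y p = frechet_derivative Y (at p) (Z p)"

definition pushforward_field ::
    "'a::real_normed_vector set \<Rightarrow> ('a \<Rightarrow> 'v::real_normed_vector) \<Rightarrow> ('a \<Rightarrow> 'a) \<Rightarrow> 'v \<Rightarrow> 'v" where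
  "pushforward_field U F Y q =
     frechet_derivative F (at (the_inv_into U F q)) (Y (the_inv_into U F q))"

definition pullback_field ::
    "('a::real_normed_vector \<Rightarrow> 'v::real_normed_vector) \<Rightarrow> ('v \<Rightarrow> 'v) \<Rightarrow> 'a \<Rightarrow> 'a" where
  "pullback_field F W p = inv (frechet_derivative F (at p)) (W (F p))"

text \<open>The pullback to \<open>U\<close> of the canonical connection of \<open>F ` U\<close>, for a diffeomorphism \<open>F\<close> of \<open>U\<close>
  onto the open set \<open>F ` U\<close>.\<close>

definition pullback_affine_connection ::
    "'a::real_normed_vector set \<Rightarrow> ('a \<Rightarrow> 'v::real_normed_vector) \<Rightarrow>
     ('a \<Rightarrow> 'a) \<Rightarrow> ('a \<Rightarrow> 'a) \<Rightarrow> 'a \<Rightarrow> 'a" where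
  "pullback_affine_connection U F Z Y =
     pullback_field F (affine_connection (pushforward_field U F Z) (pushforward_field U F Y))"

text \<open>
  A chart \<open>x\<close> on \<open>U \<subseteq> B\<close> is flat if its coordinate fields \<open>\<partial>/\<partial>x\<^sup>i\<close>, the pullbacks of the constant
  basis fields, are parallel.
\<close>

definition flat_chart ::
    "'a::euclidean_space set \<Rightarrow> (('a \<Rightarrow> 'a) \<Rightarrow> ('a \<Rightarrow> 'a) \<Rightarrow> 'a \<Rightarrow> 'a) \<Rightarrow>
     'a set \<Rightarrow> ('a \<Rightarrow> 'a) \<Rightarrow> bool" where
  "flat_chart B D U x \<longleftrightarrow> U \<subseteq> B \<and> diffeo_onto_open U x \<and>
     (\<forall>i\<in>Basis. \<forall>Z. vector_field U Z \<longrightarrow> (\<forall>p\<in>U. D Z (pullback_field x (\<lambda>_. i)) p = 0))"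

section \<open>Legendre bundles\<close>

text \<open>
  The bundle \<open>H = H\<^sup>+ \<oplus> H\<^sup>-\<close> has fibres \<open>H\<^sup>+ p \<times> H\<^sup>- p\<close>; elements of \<open>H\<^sup>+\<close> and \<open>H\<^sup>-\<close> are embedded as
  \<open>(x, 0)\<close> and \<open>(0, a)\<close>. The isomorphisms with the tangent and cotangent bundle are \<open>\<phi>\<close> and \<open>\<psi>\<close>.
\<close>

locale legendre_bundle =
  fixes B :: "'a::euclidean_space set"
    and Hp :: "'a \<Rightarrow> 'p::real_normed_vector set" and \<phi> :: "'a \<Rightarrow> 'p \<Rightarrow> 'a"
    and Hm :: "'a \<Rightarrow> 'm::real_normed_vector set" and \<psi> :: "'a \<Rightarrow> 'm \<Rightarrow> ('a \<Rightarrow>\<^sub>L real)"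
    and pairing :: "'a \<Rightarrow> 'p \<times> 'm \<Rightarrow> 'p \<times> 'm \<Rightarrow> real"
    and nablap :: "('a \<Rightarrow> 'a) \<Rightarrow> ('a \<Rightarrow> 'p) \<Rightarrow> 'a \<Rightarrow> 'p"
    and nablam :: "('a \<Rightarrow> 'a) \<Rightarrow> ('a \<Rightarrow> 'm) \<Rightarrow> 'a \<Rightarrow> 'm"
    and \<Psi> :: "'a \<Rightarrow> real"
  assumes open_base: "open B"
    and bundle_plus: "vector_bundle B Hp"
    and bundle_minus: "vector_bundle B Hm"
    and iso_plus: "bundle_iso B Hp tangent_bundle \<phi>"
    and iso_minus: "bundle_iso B Hm cotangent_bundle \<psi>"
    and pairing_sym: "\<And>p u v. \<lbrakk>p \<in> B; u \<in> Hp p \<times> Hm p; v \<in> Hp p \<times> Hm p\<rbrakk> \<Longrightarrow> pairing p u v = pairing p v u"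
    and pairing_add: "\<And>p u u' v. \<lbrakk>p \<in> B; u \<in> Hp p \<times> Hm p; u' \<in> Hp p \<times> Hm p; v \<in> Hp p \<times> Hm p\<rbrakk> \<Longrightarrow>
          pairing p (u + u') v = pairing p u v + pairing p u' v"
    and pairing_scaleR: "\<And>p c u v. \<lbrakk>p \<in> B; u \<in> Hp p \<times> Hm p; v \<in> Hp p \<times> Hm p\<rbrakk> \<Longrightarrow>
          pairing p (c *\<^sub>R u) v = c * pairing p u v"
    and pairing_smooth: "\<And>U s t. \<lbrakk>open U; U \<subseteq> B; smooth_section U (\<lambda>p. Hp p \<times> Hm p) s;
          smooth_section U (\<lambda>p. Hp p \<times> Hm p) t\<rbrakk> \<Longrightarrow> smooth_on U (\<lambda>p. pairing p (s p) (t p))"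
    and pairing_nondegenerate: "\<And>p u. \<lbrakk>p \<in> B; u \<in> Hp p \<times> Hm p; \<forall>v \<in> Hp p \<times> Hm p. pairing p u v = 0\<rbrakk> \<Longrightarrow>
          u = 0"
    and pairing_plus_plus: "\<And>p x y. \<lbrakk>p \<in> B; x \<in> Hp p; y \<in> Hp p\<rbrakk> \<Longrightarrow> pairing p (x, 0) (y, 0) = 0"
    and pairing_minus_minus: "\<And>p a b. \<lbrakk>p \<in> B; a \<in> Hm p; b \<in> Hm p\<rbrakk> \<Longrightarrow> pairing p (0, a) (0, b) = 0"
    and pairing_plus_minus: "\<And>p x a. \<lbrakk>p \<in> B; x \<in> Hp p; a \<in> Hm p\<rbrakk> \<Longrightarrow>
          pairing p (x, 0) (0, a) = blinfun_apply (\<psi> p a) (\<phi> p x)"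
    and flat_plus: "flat_connection B Hp nablap"
    and flat_minus: "flat_connection B Hm nablam"
    and duality: "\<And>U Z X \<alpha> p. \<lbrakk>open U; U \<subseteq> B; vector_field U Z; smooth_section U Hp X; smooth_section U Hm \<alpha>; p \<in> U\<rbrakk>
          \<Longrightarrow> frechet_derivative (\<lambda>q. pairing q (X q, 0) (0, \<alpha> q)) (at p) (Z p) =
                pairing p (nablap Z X p, 0) (0, \<alpha> p) + pairing p (X p, 0) (0, nablam Z \<alpha> p)"
    and torsion_free_plus: "torsion_free B (transport_connection Hp \<phi> nablap)"
    and smooth_potential: "smooth_on B \<Psi>"
    and flat_charts_exist: "\<And>p. p \<in> B \<Longrightarrow> \<exists>U x. p \<in> U \<and> flat_chart B (transport_connection Hp \<phi> nablap) U x"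
    and potential_convex: "\<And>U x. flat_chart B (transport_connection Hp \<phi> nablap) U x \<Longrightarrow>
          pos_def_hessian_on (x ` U) (\<Psi> \<circ> the_inv_into U x)"

section \<open>Exponential families\<close>

definition partition_function ::
    "'w measure \<Rightarrow> ('w \<Rightarrow> 'a::euclidean_space) \<Rightarrow> 'a \<Rightarrow> ennreal" where
  "partition_function \<mu> T \<theta> = (\<integral>\<^sup>+ \<omega>. ennreal (exp (\<theta> \<bullet> T \<omega>)) \<partial>\<mu>)"

definition log_partition :: "'w measure \<Rightarrow> ('w \<Rightarrow> 'a::euclidean_space) \<Rightarrow> 'a \<Rightarrow> real" where
  "log_partition \<mu> T \<theta> = ln (enn2real (partition_function \<mu> T \<theta>))"

definition natural_parameter_space :: "'w measure \<Rightarrow> ('w \<Rightarrow> 'a::euclidean_space) \<Rightarrow> 'a set" where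
  "natural_parameter_space \<mu> T = {\<theta>. partition_function \<mu> T \<theta> < \<infinity>}"

text \<open>The standing regularity assumptions on \<open>\<Theta>\<close> and \<open>\<Psi>\<close> are part of the definition. If \<open>\<Theta>\<close> is
  nonempty they exclude \<open>\<mu> = 0\<close>, so that every \<open>P \<theta>\<close> is a probability measure.\<close>

locale exponential_family =
  fixes \<mu> :: "'w measure" and T :: "'w \<Rightarrow> 'a::euclidean_space" and P :: "'a \<Rightarrow> 'w measure"
  assumes sigma_finite: "sigma_finite_measure \<mu>"
    and sufficient_statistic: "T \<in> borel_measurable \<mu>"
    and family: "\<And>\<theta>. \<theta> \<in> natural_parameter_space \<mu> T \<Longrightarrow>
          P \<theta> = density \<mu> (\<lambda>\<omega>. ennreal (exp (\<theta> \<bullet> T \<omega> - log_partition \<mu> T \<theta>)))"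
    and open_parameters: "open (natural_parameter_space \<mu> T)"
    and convex_parameters: "convex (natural_parameter_space \<mu> T)"
    and smooth_log_partition: "smooth_on (natural_parameter_space \<mu> T) (log_partition \<mu> T)"
    and pos_def_log_partition: "pos_def_hessian_on (natural_parameter_space \<mu> T) (log_partition \<mu> T)"

definition differential :: "('a::euclidean_space \<Rightarrow> real) \<Rightarrow> 'a \<Rightarrow> ('a \<Rightarrow>\<^sub>L real)" where
  "differential \<Psi> p = Blinfun (frechet_derivative \<Psi> (at p))"

text \<open>\<open>Y \<mapsto> g(Y, \<cdot>)\<close> for the Hessian metric \<open>g\<close>; it maps \<open>\<partial>\<^sub>j\<close> to \<open>\<Sum>\<^sub>i (\<partial>\<^sub>i \<partial>\<^sub>j \<Psi>) d\<theta>\<^sup>i\<close>.\<close>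

definition legendre_morphism :: "('a::euclidean_space \<Rightarrow> real) \<Rightarrow> 'a \<Rightarrow> 'a \<Rightarrow> ('a \<Rightarrow>\<^sub>L real)" where
  "legendre_morphism \<Psi> p Y = Blinfun (\<lambda>X. hessian \<Psi> p X Y)"

text \<open>The connection on the tangent bundle pulled back from \<open>\<Theta>\<^sup>* = d\<Psi>(\<Theta>)\<close>, for which the
  \<open>\<partial>/\<partial>\<eta>\<^sub>i\<close> are parallel, viewed on the cotangent bundle via the metric.\<close>

definition dual_connection ::
    "'a::euclidean_space set \<Rightarrow> ('a \<Rightarrow> real) \<Rightarrow>
     ('a \<Rightarrow> 'a) \<Rightarrow> ('a \<Rightarrow> 'a \<Rightarrow>\<^sub>L real) \<Rightarrow> 'a \<Rightarrow> 'a \<Rightarrow>\<^sub>L real" where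
  "dual_connection \<Theta> \<Psi> =
     transport_connection tangent_bundle (legendre_morphism \<Psi>)
       (pullback_affine_connection \<Theta> (differential \<Psi>))"

definition canonical_pairing ::
    "'a::euclidean_space \<Rightarrow> 'a \<times> ('a \<Rightarrow>\<^sub>L real) \<Rightarrow> 'a \<times> ('a \<Rightarrow>\<^sub>L real) \<Rightarrow> real" where
  "canonical_pairing p u v = blinfun_apply (snd u) (fst v) + blinfun_apply (snd v) (fst u)"

end

theory Submission
  imports Defs
begin

text \<open>
  Strict convexity makes \<open>d\<Psi>\<close> injective on the convex set \<open>\<Theta>\<close>, and by invariance of domain it is a
  homeomorphism onto an open set \<open>\<Theta>\<^sup>*\<close>, whose inverse is differentiable because the Hessian is
  invertible. The derivative of \<open>d\<Psi>\<close> is the Hessian, which is symmetric, so it coincides with the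
  Legendre morphism; hence the detour through \<open>T\<Theta>\<close> and \<open>\<Theta>\<^sup>*\<close> in the definition of \<open>\<nabla>\<^sup>-\<close> cancels and
  leaves the componentwise derivative on covector fields. For this connection flatness is the symmetry
  of second derivatives and duality is the product rule.
\<close>

section \<open>Calculus of maps of class \<open>Ck_on\<close> and of smooth maps\<close>

text \<open>Each point of an open set has a neighbourhood on which the two functions agree, so the
  derivatives there agree as well. This lets a derivative inside \<open>Ck_on\<close> be replaced by
  its explicit formula on \<open>S\<close>.\<close>

lemma Ck_on_cong:
  assumes "open S" and "\<And>x. x \<in> S \<Longrightarrow> f x = g x"
  shows "Ck_on k S f \<longleftrightarrow> Ck_on k S g"
  using assms(2)
proof (induction k arbitrary: f g)
  case 0
  then show ?case by (simp cong: continuous_on_cong)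
next
  case (Suc k)
  \<comment> \<open>One implication for arbitrary functions suffices; exchanging \<open>f\<close>
    and \<open>g\<close> gives the other.\<close>
  have imp: "Ck_on (Suc k) S g" if eq: "\<And>x. x \<in> S \<Longrightarrow> f x = g x" and f: "Ck_on (Suc k) S f"
    for f g :: "'a \<Rightarrow> 'b"
  proof -
    have der: "(g has_derivative frechet_derivative f (at x)) (at x)" if "x \<in> S" for x
      using that f has_derivative_transform_within_open[OF _ assms(1) that, of f _ UNIV g] eq
      by (auto simp: frechet_derivative_works)
    then have "frechet_derivative f (at x) = frechet_derivative g (at x)" if "x \<in> S" for x
      using that by (blast intro: frechet_derivative_at)
    then have "Ck_on k S (\<lambda>x. frechet_derivative f (at x) v) \<longleftrightarrow>
        Ck_on k S (\<lambda>x. frechet_derivative g (at x) v)" for v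
      by (intro Suc.IH) simp
    with f der show ?thesis
      by (auto simp: differentiable_def)
  qed
  show ?case
    using imp[of f g] imp[of g f] Suc.prems by metis
qed

lemma Ck_on_Suc_imp: "Ck_on (Suc k) S f \<Longrightarrow> Ck_on k S f"
proof (induction k arbitrary: f)
  case 0
  then show ?case
    by (auto intro!: differentiable_imp_continuous_on
        simp: differentiable_on_def differentiable_at_withinI)
next
  case (Suc k)
  from Suc.prems show ?case
    by (subst Ck_on.simps(2)) (use Suc.IH Ck_on.simps(2) in blast)
qed

lemma Ck_on_const: "Ck_on k S (\<lambda>x. c)"
  by (induction k arbitrary: c) auto

lemma Ck_on_bounded_linear:
  assumes "bounded_linear L" and "open S"
  shows "Ck_on k S f \<Longrightarrow> Ck_on k S (\<lambda>x. L (f x))"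
proof (induction k arbitrary: f)
  case 0
  then show ?case
    using assms(1) by (simp add: bounded_linear.continuous_on)
next
  case (Suc k)
  have der: "((\<lambda>x. L (f x)) has_derivative (\<lambda>v. L (frechet_derivative f (at x) v))) (at x)"
    if "x \<in> S" for x
    using that Suc.prems
    by (intro bounded_linear.has_derivative[OF assms(1)]) (auto simp: frechet_derivative_works)
  have "Ck_on k S (\<lambda>x. frechet_derivative (\<lambda>x. L (f x)) (at x) v)" for v
    using Suc.IH[of "\<lambda>x. frechet_derivative f (at x) v"] Suc.prems
    by (subst Ck_on_cong[OF assms(2), where g = "\<lambda>x. L (frechet_derivative f (at x) v)"])
      (simp_all flip: frechet_derivative_at[OF der])
  with der show ?case
    by (auto simp: differentiable_def)
qed

lemma Ck_on_add:
  assumes "open S"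
  shows "Ck_on k S f \<Longrightarrow> Ck_on k S g \<Longrightarrow> Ck_on k S (\<lambda>x. f x + g x)"
proof (induction k arbitrary: f g)
  case 0
  then show ?case by (simp add: continuous_on_add)
next
  case (Suc k)
  have der: "((\<lambda>x. f x + g x) has_derivative
      (\<lambda>v. frechet_derivative f (at x) v + frechet_derivative g (at x) v)) (at x)"
    if "x \<in> S" for x
    using that Suc.prems
    by (intro has_derivative_add) (auto simp: frechet_derivative_works)
  have "Ck_on k S (\<lambda>x. frechet_derivative (\<lambda>x. f x + g x) (at x) v)" for v
    using Suc.IH Suc.prems
    by (subst Ck_on_cong[OF assms,
          where g = "\<lambda>x. frechet_derivative f (at x) v + frechet_derivative g (at x) v"])
      (simp_all flip: frechet_derivative_at[OF der])
  with der show ?case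
    by (auto simp: differentiable_def)
qed

text \<open>The product rule mixes the functions with their derivatives, so the induction step first
  lowers \<open>f\<close> and \<open>g\<close> to class \<open>k\<close> by
  \<open>Ck_on_Suc_imp\<close>.\<close>

lemma Ck_on_bilinear:
  assumes "bounded_bilinear b" and "open S"
  shows "Ck_on k S f \<Longrightarrow> Ck_on k S g \<Longrightarrow> Ck_on k S (\<lambda>x. b (f x) (g x))"
proof (induction k arbitrary: f g)
  case 0
  then show ?case using assms(1) by (simp add: bounded_bilinear.continuous_on)
next
  case (Suc k)
  have der: "((\<lambda>x. b (f x) (g x)) has_derivative
      (\<lambda>v. b (f x) (frechet_derivative g (at x) v) + b (frechet_derivative f (at x) v) (g x))) (at x)"
    if "x \<in> S" for x
    using that Suc.prems
    by (intro bounded_bilinear.FDERIV[OF assms(1)]) (auto simp: frechet_derivative_works)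
  have "Ck_on k S f" "Ck_on k S g"
    using Suc.prems by (auto intro: Ck_on_Suc_imp)
  then have "Ck_on k S (\<lambda>x. b (f x) (frechet_derivative g (at x) v) +
      b (frechet_derivative f (at x) v) (g x))" for v
    using Suc.prems by (intro Ck_on_add[OF assms(2)] Suc.IH) auto
  then have "Ck_on k S (\<lambda>x. frechet_derivative (\<lambda>x. b (f x) (g x)) (at x) v)" for v
    by (subst Ck_on_cong[OF assms(2), where g = "\<lambda>x. b (f x) (frechet_derivative g (at x) v) +
      b (frechet_derivative f (at x) v) (g x)"]) (simp_all flip: frechet_derivative_at[OF der])
  with der show ?case
    by (auto simp: differentiable_def)
qed

lemma smooth_on_cong:
  "open S \<Longrightarrow> (\<And>x. x \<in> S \<Longrightarrow> f x = g x) \<Longrightarrow> smooth_on S f \<longleftrightarrow> smooth_on S g"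
  by (simp add: smooth_on_def Ck_on_cong[of S f g])

lemma smooth_on_const: "smooth_on S (\<lambda>x. c)"
  by (simp add: smooth_on_def Ck_on_const)

lemma smooth_on_add:
  "open S \<Longrightarrow> smooth_on S f \<Longrightarrow> smooth_on S g \<Longrightarrow> smooth_on S (\<lambda>x. f x + g x)"
  by (simp add: smooth_on_def Ck_on_add)

lemma smooth_on_sum:
  "finite I \<Longrightarrow> open S \<Longrightarrow> (\<And>i. i \<in> I \<Longrightarrow> smooth_on S (f i)) \<Longrightarrow> smooth_on S (\<lambda>x. \<Sum>i\<in>I. f i x)"
  by (induction I rule: finite_induct) (auto simp: smooth_on_const intro: smooth_on_add)

lemma smooth_on_bounded_linear:
  "bounded_linear L \<Longrightarrow> open S \<Longrightarrow> smooth_on S f \<Longrightarrow> smooth_on S (\<lambda>x. L (f x))"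
  by (simp add: smooth_on_def Ck_on_bounded_linear)

lemma smooth_on_bilinear:
  "bounded_bilinear b \<Longrightarrow> open S \<Longrightarrow> smooth_on S f \<Longrightarrow> smooth_on S g \<Longrightarrow>
    smooth_on S (\<lambda>x. b (f x) (g x))"
  by (simp add: smooth_on_def Ck_on_bilinear)

lemma smooth_on_directional: "smooth_on S f \<Longrightarrow> smooth_on S (\<lambda>x. frechet_derivative f (at x) v)"
  by (metis Ck_on.simps(2) smooth_on_def)

lemma smooth_on_has_derivative:
  "smooth_on S f \<Longrightarrow> x \<in> S \<Longrightarrow> (f has_derivative frechet_derivative f (at x)) (at x)"
  by (metis Ck_on.simps(2) frechet_derivative_works smooth_on_def)

lemma smooth_on_bounded_linear_derivative:
  "smooth_on S f \<Longrightarrow> x \<in> S \<Longrightarrow> bounded_linear (frechet_derivative f (at x))"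
  by (rule has_derivative_bounded_linear[OF smooth_on_has_derivative])

lemma smooth_on_continuous_on: "smooth_on S f \<Longrightarrow> continuous_on S f"
  by (metis Ck_on.simps(1) smooth_on_def)

lemma smooth_on_id: "smooth_on S (\<lambda>x. x)"
proof -
  have "Ck_on k S (\<lambda>x. x)" for k
    by (cases k) (auto simp: Ck_on_const)
  then show ?thesis
    by (simp add: smooth_on_def)
qed

section \<open>Derivatives along vector fields and symmetry of second derivatives\<close>

lemma linear_sum_Basis:
  assumes "linear L"
  shows "L v = (\<Sum>i\<in>Basis. (v \<bullet> i) *\<^sub>R L i)"
proof -
  have "L v = L (\<Sum>i\<in>Basis. (v \<bullet> i) *\<^sub>R i)"
    by (simp add: euclidean_representation)
  then show ?thesis
    using assms by (simp add: linear_sum linear_cmul)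
qed

text \<open>\<open>Ck_on\<close> speaks of fixed directions only. Expanding \<open>Z x\<close> in
  \<open>Basis\<close> leaves finitely many fixed directions with smooth coefficients.\<close>

lemma smooth_on_derivative_along:
  assumes "open S" and "smooth_on S f" and "smooth_on S Z"
  shows "smooth_on S (\<lambda>x. frechet_derivative f (at x) (Z x))"
proof -
  have "smooth_on S (\<lambda>x. \<Sum>i\<in>Basis. (Z x \<bullet> i) *\<^sub>R frechet_derivative f (at x) i)"
    using assms
    by (intro smooth_on_sum smooth_on_bilinear[OF bounded_bilinear_scaleR] smooth_on_directional
        smooth_on_bounded_linear[OF bounded_linear_inner_left]) auto
  moreover have "frechet_derivative f (at x) (Z x) =
      (\<Sum>i\<in>Basis. (Z x \<bullet> i) *\<^sub>R frechet_derivative f (at x) i)" if "x \<in> S" for x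
    using that assms(2)
    by (intro linear_sum_Basis has_derivative_linear[OF smooth_on_has_derivative])
  ultimately show ?thesis
    by (subst smooth_on_cong[OF assms(1)])
qed

text \<open>Product rule for a derivative evaluated on a moving vector: one term differentiates
  \<open>f\<close> again with the vector frozen, the other differentiates the vector.\<close>

lemma derivative_along_has_derivative:
  assumes f: "smooth_on S f" and Z: "(Z has_derivative Z') (at x)" and S: "open S" "x \<in> S"
  shows "((\<lambda>x. frechet_derivative f (at x) (Z x)) has_derivative
    (\<lambda>h. frechet_derivative (\<lambda>q. frechet_derivative f (at q) (Z x)) (at x) h +
         frechet_derivative f (at x) (Z' h))) (at x)"
proof -
  let ?D = "\<lambda>v q. frechet_derivative f (at q) v"
  have lin: "linear (frechet_derivative f (at q))" if "q \<in> S" for q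
    using that f by (intro has_derivative_linear[OF smooth_on_has_derivative])
  have D: "(?D v has_derivative frechet_derivative (?D v) (at x)) (at x)" for v
    using f S(2) by (intro smooth_on_has_derivative smooth_on_directional)
  have "((\<lambda>q. \<Sum>i\<in>Basis. (Z q \<bullet> i) *\<^sub>R ?D i q) has_derivative
      (\<lambda>h. \<Sum>i\<in>Basis. (Z x \<bullet> i) *\<^sub>R frechet_derivative (?D i) (at x) h + (Z' h \<bullet> i) *\<^sub>R ?D i x)) (at x)"
    by (intro has_derivative_sum bounded_bilinear.FDERIV[OF bounded_bilinear_scaleR] D
        bounded_linear.has_derivative[OF bounded_linear_inner_left] Z)
  then have "((\<lambda>q. ?D (Z q) q) has_derivative
      (\<lambda>h. \<Sum>i\<in>Basis. (Z x \<bullet> i) *\<^sub>R frechet_derivative (?D i) (at x) h + (Z' h \<bullet> i) *\<^sub>R ?D i x)) (at x)"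
    by (rule has_derivative_transform_within_open[OF _ S]) (use linear_sum_Basis[OF lin] in auto)
  \<comment> \<open>The same expansion with the vector frozen at \<open>Z x\<close> identifies the
    first half of the sum above as the second derivative in that direction.\<close>
  moreover have "((\<lambda>q. \<Sum>i\<in>Basis. (Z x \<bullet> i) *\<^sub>R ?D i q) has_derivative
      (\<lambda>h. \<Sum>i\<in>Basis. (Z x \<bullet> i) *\<^sub>R frechet_derivative (?D i) (at x) h)) (at x)"
    by (intro has_derivative_sum D bounded_linear.has_derivative[OF bounded_linear_scaleR_right])
  then have "(?D (Z x) has_derivative
      (\<lambda>h. \<Sum>i\<in>Basis. (Z x \<bullet> i) *\<^sub>R frechet_derivative (?D i) (at x) h)) (at x)"
    by (rule has_derivative_transform_within_open[OF _ S]) (use linear_sum_Basis[OF lin] in auto)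
  note fun_cong[OF frechet_derivative_at[OF this]]
  moreover have "?D (Z' h) x = (\<Sum>i\<in>Basis. (Z' h \<bullet> i) *\<^sub>R ?D i x)" for h
    using linear_sum_Basis[OF lin[OF S(2)]] by blast
  ultimately show ?thesis
    by (simp add: sum.distrib)
qed

text \<open>The second difference of \<open>f\<close> over the parallelogram spanned by \<open>t u\<close> and \<open>t v\<close> is
  \<open>t\<^sup>2 \<partial>\<^sub>u \<partial>\<^sub>v f + o(t\<^sup>2)\<close> and symmetric in \<open>u\<close> and \<open>v\<close>.\<close>

lemma second_difference_bound:
  fixes f :: "'a::real_normed_vector \<Rightarrow> 'b::real_normed_vector"
  assumes t: "0 < t" "t * (norm u + norm v) < d"
    and f: "\<And>q. dist q x < d \<Longrightarrow> (f has_derivative f' q) (at q)"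
    and f': "\<And>q. dist q x < d \<Longrightarrow> ((\<lambda>q. f' q v) has_derivative f'' q) (at q)"
    and near: "\<And>q. dist q x < d \<Longrightarrow> norm (f'' q u - A) \<le> e"
  shows "norm (f (x + t *\<^sub>R u + t *\<^sub>R v) - f (x + t *\<^sub>R u) - f (x + t *\<^sub>R v) + f x - (t * t) *\<^sub>R A)
    \<le> e * t * t"
proof -
  \<comment> \<open>The whole parallelogram stays within distance \<open>d\<close> of
    \<open>x\<close>, where the hypotheses apply.\<close>
  have ball: "dist (x + s *\<^sub>R u + r *\<^sub>R v) x < d" if "s \<in> {0..t}" "r \<in> {0..t}" for s r
  proof -
    have "norm (s *\<^sub>R u + r *\<^sub>R v) \<le> s * norm u + r * norm v"
      using that norm_triangle_ineq[of "s *\<^sub>R u" "r *\<^sub>R v"] by simp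
    also have "\<dots> \<le> t * norm u + t * norm v"
      using that by (intro add_mono mult_right_mono) auto
    finally show ?thesis
      using t(2) by (simp add: dist_norm distrib_left add.assoc)
  qed
  \<comment> \<open>First mean value estimate, along \<open>u\<close>: the function of
    \<open>s\<close> has derivative \<open>f'' _ u - A\<close>, which is bounded by
    \<open>e\<close>.\<close>
  have inner: "norm (f' (x + t *\<^sub>R u + r *\<^sub>R v) v - f' (x + r *\<^sub>R v) v - t *\<^sub>R A) \<le> e * t"
    if r: "r \<in> {0..t}" for r
  proof -
    let ?\<psi> = "\<lambda>s. f' (x + s *\<^sub>R u + r *\<^sub>R v) v - s *\<^sub>R A"
    have "(?\<psi> has_derivative (\<lambda>h. h *\<^sub>R (f'' (x + s *\<^sub>R u + r *\<^sub>R v) u - A))) (at s within {0..t})"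
      if s: "s \<in> {0..t}" for s
    proof -
      note D = f'[OF ball[OF s r]]
      have "((\<lambda>s. x + s *\<^sub>R u + r *\<^sub>R v) has_derivative (\<lambda>h. h *\<^sub>R u)) (at s within {0..t})"
        by (auto intro!: derivative_eq_intros)
      from has_derivative_compose[OF this D]
      have "((\<lambda>s. f' (x + s *\<^sub>R u + r *\<^sub>R v) v) has_derivative
          (\<lambda>h. f'' (x + s *\<^sub>R u + r *\<^sub>R v) (h *\<^sub>R u))) (at s within {0..t})" .
      then show ?thesis
        using linear_cmul[OF has_derivative_linear[OF D]]
        by (auto intro!: derivative_eq_intros simp: scaleR_diff_right)
    qed
    moreover have "onorm (\<lambda>h::real. h *\<^sub>R (f'' (x + s *\<^sub>R u + r *\<^sub>R v) u - A)) \<le> e"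
      if s: "s \<in> {0..t}" for s
      using near[OF ball[OF s r]] by (intro onorm_le) (simp add: mult.commute[of e] mult_left_mono)
    ultimately have "norm (?\<psi> t - ?\<psi> 0) \<le> e * norm (t - 0)"
      using t by (intro differentiable_bound[of "{0..t}"]) auto
    then show ?thesis
      using t by (simp add: algebra_simps)
  qed
  \<comment> \<open>Second mean value estimate, along \<open>v\<close>: the increment of this
    function from \<open>0\<close> to \<open>t\<close> is the second difference minus
    \<open>(t * t) *\<^sub>R A\<close>, and \<open>inner\<close> bounds its derivative.\<close>
  let ?\<phi> = "\<lambda>r. f (x + t *\<^sub>R u + r *\<^sub>R v) - f (x + r *\<^sub>R v) - r *\<^sub>R (t *\<^sub>R A)"
  let ?\<phi>' = "\<lambda>r. f' (x + t *\<^sub>R u + r *\<^sub>R v) v - f' (x + r *\<^sub>R v) v - t *\<^sub>R A"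
  have "(?\<phi> has_derivative (\<lambda>h. h *\<^sub>R ?\<phi>' r)) (at r within {0..t})" if r: "r \<in> {0..t}" for r
  proof -
    note D = f[OF ball[OF _ r, of t]] f[OF ball[OF _ r, of 0], simplified]
    have "((\<lambda>r. w + r *\<^sub>R v) has_derivative (\<lambda>h. h *\<^sub>R v)) (at r within {0..t})" for w
      by (auto intro!: derivative_eq_intros)
    from has_derivative_compose[OF this D(1)] has_derivative_compose[OF this D(2)] t
    have "((\<lambda>r. f (x + t *\<^sub>R u + r *\<^sub>R v)) has_derivative
          (\<lambda>h. f' (x + t *\<^sub>R u + r *\<^sub>R v) (h *\<^sub>R v))) (at r within {0..t})"
      "((\<lambda>r. f (x + r *\<^sub>R v)) has_derivative (\<lambda>h. f' (x + r *\<^sub>R v) (h *\<^sub>R v))) (at r within {0..t})"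
      by auto
    then show ?thesis
      using linear_cmul[OF has_derivative_linear[OF D(1)]] linear_cmul[OF has_derivative_linear[OF D(2)]] t
      by (auto intro!: derivative_eq_intros simp: scaleR_diff_right)
  qed
  moreover have "onorm (\<lambda>h::real. h *\<^sub>R ?\<phi>' r) \<le> e * t" if "r \<in> {0..t}" for r
    using inner[OF that] by (intro onorm_le) (simp add: mult.commute[of "e * t"] mult_left_mono)
  ultimately have "norm (?\<phi> t - ?\<phi> 0) \<le> e * t * norm (t - 0)"
    using t by (intro differentiable_bound[of "{0..t}"]) auto
  then show ?thesis
    using t by (simp add: algebra_simps)
qed

text \<open>By continuity of the mixed derivatives, both are within \<open>e\<close> of the same
  second difference divided by \<open>t * t\<close>. Letting \<open>e\<close> tend to zero gives
  equality.\<close>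

lemma smooth_second_derivative_symmetric:
  assumes f: "smooth_on S f" and S: "open S" "x \<in> S"
  shows "frechet_derivative (\<lambda>q. frechet_derivative f (at q) v) (at x) u =
    frechet_derivative (\<lambda>q. frechet_derivative f (at q) u) (at x) v"
proof -
  define f2 where "f2 u v q = frechet_derivative (\<lambda>q. frechet_derivative f (at q) v) (at q) u" for u v q
  have close: "\<exists>d>0. \<forall>q. dist q x < d \<longrightarrow> q \<in> S \<and> norm (f2 u v q - f2 u v x) \<le> e" if e: "e > 0" for e u v
  proof -
    have "continuous_on S (f2 u v)"
      unfolding f2_def by (intro smooth_on_continuous_on smooth_on_directional f)
    then have "continuous (at x) (f2 u v)"
      using S by (simp add: continuous_on_eq_continuous_at)
    then obtain d where d: "d > 0" "\<forall>q. dist q x < d \<longrightarrow> dist (f2 u v q) (f2 u v x) < e"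
      using e unfolding continuous_at_eps_delta by blast
    obtain d' where "d' > 0" "\<forall>q. dist q x < d' \<longrightarrow> q \<in> S"
      using S open_dist by blast
    with d show ?thesis
      by (intro exI[of _ "min d d'"]) (force simp: dist_norm)
  qed
  have bound: "norm (f2 u v x - f2 v u x) \<le> 2 * e" if e: "e > 0" for e
  proof -
    obtain d1 where d1: "d1 > 0" "\<forall>q. dist q x < d1 \<longrightarrow> q \<in> S \<and> norm (f2 u v q - f2 u v x) \<le> e"
      using close[OF e] by blast
    obtain d2 where d2: "d2 > 0" "\<forall>q. dist q x < d2 \<longrightarrow> q \<in> S \<and> norm (f2 v u q - f2 v u x) \<le> e"
      using close[OF e] by blast
    define d where "d = min d1 d2"
    \<comment> \<open>The added 1 keeps the denominator positive for \<open>u = v = 0\<close> and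
      makes the parallelogram fit strictly inside the ball.\<close>
    define t where "t = d / (norm u + norm v + 1)"
    have d: "d > 0"
      using d1 d2 by (simp add: d_def)
    have pos: "norm u + norm v + 1 > 0"
      by (simp add: add_nonneg_pos)
    have t: "t > 0"
      using d pos by (simp add: t_def)
    have "t * (norm u + norm v + 1) = d"
      using pos by (simp add: t_def)
    with t have t2: "t * (norm u + norm v) < d"
      by (simp add: algebra_simps)
    have D: "(f has_derivative frechet_derivative f (at q)) (at q)"
      "((\<lambda>q. frechet_derivative f (at q) w) has_derivative (\<lambda>h. f2 h w q)) (at q)"
      if "dist q x < d" for q w
      using that d1 f unfolding f2_def d_def
      by (auto intro: smooth_on_has_derivative smooth_on_directional)
    let ?\<Delta> = "f (x + t *\<^sub>R u + t *\<^sub>R v) - f (x + t *\<^sub>R u) - f (x + t *\<^sub>R v) + f x"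
    have 1: "norm (?\<Delta> - (t * t) *\<^sub>R f2 u v x) \<le> e * t * t"
      using d1 by (intro second_difference_bound[OF t t2 D]) (auto simp: d_def)
    \<comment> \<open>The same estimate with \<open>u\<close> and \<open>v\<close> exchanged; after
      reordering the summands it concerns the same \<open>?\<Delta>\<close>.\<close>
    have "norm (f (x + t *\<^sub>R v + t *\<^sub>R u) - f (x + t *\<^sub>R v) - f (x + t *\<^sub>R u) + f x
        - (t * t) *\<^sub>R f2 v u x) \<le> e * t * t"
      using d2 t2 by (intro second_difference_bound[OF t _ D, where d = d]) (auto simp: d_def add.commute)
    then have 2: "norm (?\<Delta> - (t * t) *\<^sub>R f2 v u x) \<le> e * t * t"
      by (simp add: algebra_simps)
    have "(t * t) * norm (f2 u v x - f2 v u x) = norm ((?\<Delta> - (t * t) *\<^sub>R f2 v u x) - (?\<Delta> - (t * t) *\<^sub>R f2 u v x))"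
      using t by (simp flip: scaleR_diff_right)
    also have "\<dots> \<le> (t * t) * (2 * e)"
      using norm_triangle_ineq4[of "?\<Delta> - (t * t) *\<^sub>R f2 v u x" "?\<Delta> - (t * t) *\<^sub>R f2 u v x"] 1 2
      by (simp add: algebra_simps)
    finally show ?thesis
      using t by (subst (asm) mult_le_cancel_left_pos) auto
  qed
  \<comment> \<open>The summand 0 gives the bound the shape that \<open>field_le_epsilon\<close>
    expects.\<close>
  have "norm (f2 u v x - f2 v u x) \<le> 0 + e" if "e > 0" for e
    using bound[of "e / 2"] that by linarith
  then have "norm (f2 u v x - f2 v u x) \<le> 0"
    by (rule field_le_epsilon)
  then have "f2 u v x = f2 v u x"
    by simp
  then show ?thesis
    unfolding f2_def .
qed

section \<open>Connections given by directional derivatives\<close>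

text \<open>In the curvature the second derivatives of \<open>s\<close> cancel by symmetry, and the
  remaining first-order terms are the derivative of \<open>s\<close> along the Lie bracket.
  Agreement with the directional derivative is asked of smooth sections only, so that the lemma
  serves both \<nabla>^+ and \<nabla>^-.\<close>

lemma flat_connection_directional:
  fixes D :: "('a::euclidean_space \<Rightarrow> 'a) \<Rightarrow> ('a \<Rightarrow> 'e::real_normed_vector) \<Rightarrow> 'a \<Rightarrow> 'e"
  assumes D: "\<And>U Z s p. open U \<Longrightarrow> U \<subseteq> B \<Longrightarrow> smooth_on U s \<Longrightarrow> p \<in> U \<Longrightarrow>
      D Z s p = frechet_derivative s (at p) (Z p)"
    and E: "\<And>p. E p = UNIV"
  shows "flat_connection B E D"
  unfolding flat_connection_def
proof (intro conjI allI impI ballI)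
  show "connection B E D"
    unfolding connection_def
  proof (intro allI impI)
    fix U Z s
    assume "open U \<and> U \<subseteq> B \<and> vector_field U Z \<and> smooth_section U E s"
    then have U: "open U" "U \<subseteq> B" and Z: "smooth_on U Z" and s: "smooth_on U s"
      by (auto simp: smooth_section_def)
    note DU = D[OF U]
    have lin: "linear (frechet_derivative s (at p))" if "p \<in> U" for p
      by (intro has_derivative_linear[OF smooth_on_has_derivative[OF s that]])
    have "smooth_on U (\<lambda>p. frechet_derivative s (at p) (Z p))"
      by (rule smooth_on_derivative_along[OF U(1) s Z])
    then have "smooth_on U (D Z s)"
      by (subst smooth_on_cong[OF U(1) DU[OF s]])
    then have "smooth_section U E (D Z s)"
      by (simp add: smooth_section_def E)
    moreover have "D (\<lambda>q. Z q + Z' q) s p = D Z s p + D Z' s p" if "p \<in> U" for Z' p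
      using that by (simp add: DU[OF s] linear_add[OF lin])
    moreover have "D (\<lambda>q. f q *\<^sub>R Z q) s p = f p *\<^sub>R D Z s p" if "p \<in> U" for f p
      using that by (simp add: DU[OF s] linear_cmul[OF lin])
    moreover have "D Z (\<lambda>q. s q + s' q) p = D Z s p + D Z s' p"
      if s': "smooth_on U s'" and p: "p \<in> U" for s' p
    proof -
      note der = has_derivative_add[OF smooth_on_has_derivative[OF s p] smooth_on_has_derivative[OF s' p]]
      show ?thesis
        by (simp add: DU[OF s p] DU[OF s' p] DU[OF smooth_on_add[OF U(1) s s'] p]
            flip: frechet_derivative_at[OF der])
    qed
    moreover have "D Z (\<lambda>q. f q *\<^sub>R s q) p =
        frechet_derivative f (at p) (Z p) *\<^sub>R s p + f p *\<^sub>R D Z s p"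
      if f: "smooth_on U f" and p: "p \<in> U" for f p
    proof -
      note der = has_derivative_scaleR[OF smooth_on_has_derivative[OF f p] smooth_on_has_derivative[OF s p]]
      show ?thesis
        by (simp add: DU[OF s p] DU[OF smooth_on_bilinear[OF bounded_bilinear_scaleR U(1) f s] p]
            flip: frechet_derivative_at[OF der])
    qed
    ultimately show "smooth_section U E (D Z s) \<and>
        (\<forall>Z'. vector_field U Z' \<longrightarrow> (\<forall>p\<in>U. D (\<lambda>q. Z q + Z' q) s p = D Z s p + D Z' s p)) \<and>
        (\<forall>f. smooth_on U f \<longrightarrow> (\<forall>p\<in>U. D (\<lambda>q. f q *\<^sub>R Z q) s p = f p *\<^sub>R D Z s p)) \<and>
        (\<forall>s'. smooth_section U E s' \<longrightarrow>
           (\<forall>p\<in>U. D Z (\<lambda>q. s q + s' q) p = D Z s p + D Z s' p)) \<and>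
        (\<forall>f. smooth_on U f \<longrightarrow>
           (\<forall>p\<in>U. D Z (\<lambda>q. f q *\<^sub>R s q) p =
              frechet_derivative f (at p) (Z p) *\<^sub>R s p + f p *\<^sub>R D Z s p))"
      by (simp add: smooth_section_def)
  qed
next
  fix U X Y s p
  assume "open U \<and> U \<subseteq> B \<and> vector_field U X \<and> vector_field U Y \<and> smooth_section U E s" and p: "p \<in> U"
  then have U: "open U" "U \<subseteq> B" and X: "smooth_on U X" and Y: "smooth_on U Y" and s: "smooth_on U s"
    by (auto simp: smooth_section_def)
  note DU = D[OF U]
  \<comment> \<open>Stated for all \<open>X\<close> and \<open>Y\<close> so that it covers both
    orders of differentiation.\<close>
  have DD: "D X (D Y s) p = frechet_derivative (\<lambda>q. frechet_derivative s (at q) (Y p)) (at p) (X p) +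
      frechet_derivative s (at p) (frechet_derivative Y (at p) (X p))"
    if Y: "smooth_on U Y" for X Y
  proof -
    have "smooth_on U (D Y s)"
      by (subst smooth_on_cong[OF U(1) DU[OF s]]) (simp_all add: smooth_on_derivative_along U s Y)
    then have "D X (D Y s) p = frechet_derivative (D Y s) (at p) (X p)"
      by (rule DU) (rule p)
    moreover have "(D Y s has_derivative
        (\<lambda>h. frechet_derivative (\<lambda>q. frechet_derivative s (at q) (Y p)) (at p) h +
          frechet_derivative s (at p) (frechet_derivative Y (at p) h))) (at p)"
      by (rule has_derivative_transform_within_open
          [OF derivative_along_has_derivative[OF s smooth_on_has_derivative[OF Y p] U(1) p] U(1) p])
        (simp add: DU[OF s])
    ultimately show ?thesis
      by (simp flip: frechet_derivative_at)
  qed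
  have "linear (frechet_derivative s (at p))"
    by (intro has_derivative_linear[OF smooth_on_has_derivative[OF s p]])
  then show "D X (D Y s) p - D Y (D X s) p - D (lie_bracket X Y) s p = 0"
    using smooth_second_derivative_symmetric[OF s U(1) p, of "X p" "Y p"]
    by (simp add: DD X Y DU[OF s p] lie_bracket_def linear_diff)
qed

section \<open>Frames of the tangent and cotangent bundles, and coordinates on the dual
  space\<close>

text \<open>A basis of the fibre, taken constant in the point, is a global frame; \<open>h\<close>
  renumbers it by an initial segment of the naturals.\<close>

lemma vector_bundle_trivial:
  fixes B :: "'a::euclidean_space set" and E :: "'a \<Rightarrow> 'e::real_normed_vector set" and e :: "'i \<Rightarrow> 'e"
  assumes "open B" and "finite I" and "inj_on e I" and "independent (e ` I)" and "span (e ` I) = UNIV"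
    and "\<And>p. E p = UNIV"
  shows "vector_bundle B E"
proof -
  obtain h where h: "bij_betw h {..<card I} I"
    using ex_bij_betw_nat_finite[OF assms(2)] by (auto simp: atLeast0LessThan)
  then have "inj_on (e \<circ> h) {..<card I}" and "(e \<circ> h) ` {..<card I} = e ` I"
    using assms(3) by (simp_all only: bij_betw_def comp_inj_on image_comp[symmetric])
  then have frame: "inj_on (\<lambda>i. e (h i)) {..<card I}" "(\<lambda>i. e (h i)) ` {..<card I} = e ` I"
    by (simp_all only: o_def)
  show ?thesis
    unfolding vector_bundle_def
  proof
    fix p
    assume "p \<in> B"
    then show "\<exists>U (r::nat) e. open U \<and> p \<in> U \<and> U \<subseteq> B \<and> (\<forall>i<r. smooth_on U (e i)) \<and>
        (\<forall>q\<in>U. inj_on (\<lambda>i. e i q) {..<r} \<and> independent ((\<lambda>i. e i q) ` {..<r}) \<and>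
                span ((\<lambda>i. e i q) ` {..<r}) = E q)"
      using assms(1,4-6) frame
      by (intro exI[of _ B] exI[of _ "card I"] exI[of _ "\<lambda>i _. e (h i)"]) (simp add: smooth_on_const)
  qed
qed

lemma vector_bundle_tangent: "open B \<Longrightarrow> vector_bundle B tangent_bundle"
  by (rule vector_bundle_trivial[where I = Basis and e = "\<lambda>x. x"])
    (simp_all add: tangent_bundle_def independent_Basis)

text \<open>The covectors \<open>blinfun_inner_left i\<close> are the basis dual to
  \<open>Basis\<close>.\<close>

lemma blinfun_real_eq_sum:
  fixes \<alpha> :: "'a::euclidean_space \<Rightarrow>\<^sub>L real"
  shows "\<alpha> = (\<Sum>i\<in>Basis. \<alpha> i *\<^sub>R blinfun_inner_left i)"
proof (rule blinfun_eqI)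
  fix x
  show "\<alpha> x = (\<Sum>i\<in>Basis. \<alpha> i *\<^sub>R blinfun_inner_left i) x"
    using linear_sum_Basis[of "blinfun_apply \<alpha>" x]
    by (simp add: blinfun.sum_left blinfun.scaleR_left blinfun.bounded_linear_right
        bounded_linear.linear mult.commute inner_commute)
qed

lemma vector_bundle_cotangent:
  assumes "open B"
  shows "vector_bundle B (cotangent_bundle :: 'a::euclidean_space \<Rightarrow> _)"
proof (rule vector_bundle_trivial[where I = Basis and e = blinfun_inner_left])
  have apply_eq: "blinfun_apply (blinfun_inner_left i) j = (if i = j then 1 else 0)"
    if "i \<in> Basis" "j \<in> Basis" for i j :: 'a
    using that by (simp add: inner_Basis)
  show inj: "inj_on blinfun_inner_left (Basis :: 'a set)"
    by (rule inj_onI) (metis apply_eq one_neq_zero)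
  show "independent (blinfun_inner_left ` (Basis :: 'a set))"
  proof (rule independent_if_scalars_zero)
    fix c :: "('a \<Rightarrow>\<^sub>L real) \<Rightarrow> real" and \<beta> :: "'a \<Rightarrow>\<^sub>L real"
    assume sum: "(\<Sum>x\<in>blinfun_inner_left ` Basis. c x *\<^sub>R x) = 0"
      and "\<beta> \<in> blinfun_inner_left ` Basis"
    then obtain j where j: "j \<in> Basis" "\<beta> = blinfun_inner_left j"
      by blast
    \<comment> \<open>Evaluation at \<open>j\<close> isolates the coefficient of the dual basis
      covector belonging to \<open>j\<close>.\<close>
    have "0 = blinfun_apply (\<Sum>i\<in>Basis. c (blinfun_inner_left i) *\<^sub>R blinfun_inner_left i) j"
      using sum by (simp add: sum.reindex[OF inj])
    also have "\<dots> = (\<Sum>i\<in>Basis. if i = j then c (blinfun_inner_left i) else 0)"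
      using j unfolding blinfun.sum_left
      by (intro sum.cong) (auto simp: blinfun.scaleR_left apply_eq simp del: blinfun_inner_left.rep_eq)
    finally show "c \<beta> = 0"
      using j by simp
  qed simp
  have "\<alpha> \<in> span (blinfun_inner_left ` Basis)" for \<alpha> :: "'a \<Rightarrow>\<^sub>L real"
    by (subst blinfun_real_eq_sum) (intro span_sum span_scale span_base, simp)
  then show "span (blinfun_inner_left ` (Basis :: 'a set)) = UNIV"
    by blast
qed (auto simp: assms cotangent_bundle_def)

text \<open>Coordinates on the dual space, needed because invariance of domain is available only for
  maps of a Euclidean space to itself.\<close>

definition dual_coords :: "('a::euclidean_space \<Rightarrow>\<^sub>L real) \<Rightarrow> 'a" where
  "dual_coords \<alpha> = (\<Sum>i\<in>Basis. \<alpha> i *\<^sub>R i)"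

lemma bounded_linear_dual_coords: "bounded_linear dual_coords"
  unfolding dual_coords_def
  by (intro bounded_linear_sum bounded_linear_scaleR_const blinfun.bounded_linear_left)

lemma inj_dual_coords: "inj dual_coords"
proof (rule injI)
  fix \<alpha> \<beta> :: "'a \<Rightarrow>\<^sub>L real"
  assume eq: "dual_coords \<alpha> = dual_coords \<beta>"
  have "\<gamma> i = dual_coords \<gamma> \<bullet> i" if "i \<in> Basis" for \<gamma> :: "'a \<Rightarrow>\<^sub>L real" and i
    using that by (simp add: dual_coords_def)
  with eq show "\<alpha> = \<beta>"
    by (metis blinfun_euclidean_eqI)
qed

section \<open>Hessian geometry of a strictly convex potential\<close>

text \<open>Collects the properties of \<open>log_partition\<close> on which the geometry rests, so
  that the construction is carried out for a general potential.\<close>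

locale convex_potential =
  fixes \<Theta> :: "'a::euclidean_space set" and \<Psi> :: "'a \<Rightarrow> real"
  assumes open_domain: "open \<Theta>"
    and convex_domain: "convex \<Theta>"
    and smooth: "smooth_on \<Theta> \<Psi>"
    and pos_def: "pos_def_hessian_on \<Theta> \<Psi>"
begin

lemma hessian_symmetric: "p \<in> \<Theta> \<Longrightarrow> hessian \<Psi> p u v = hessian \<Psi> p v u"
  unfolding hessian_def by (rule smooth_second_derivative_symmetric[OF smooth open_domain])

lemma partial_has_derivative:
  "p \<in> \<Theta> \<Longrightarrow> ((\<lambda>q. frechet_derivative \<Psi> (at q) v) has_derivative (\<lambda>u. hessian \<Psi> p u v)) (at p)"
  unfolding hessian_def by (rule smooth_on_has_derivative[OF smooth_on_directional[OF smooth]])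

lemma differential_apply: "p \<in> \<Theta> \<Longrightarrow> differential \<Psi> p v = frechet_derivative \<Psi> (at p) v"
  by (simp add: differential_def bounded_linear_Blinfun_apply
      smooth_on_bounded_linear_derivative[OF smooth])

lemma legendre_apply: "p \<in> \<Theta> \<Longrightarrow> legendre_morphism \<Psi> p Y X = hessian \<Psi> p X Y"
  by (simp add: legendre_morphism_def bounded_linear_Blinfun_apply
      has_derivative_bounded_linear[OF partial_has_derivative])

text \<open>In the dual basis the components of d\<Psi> are the partial derivatives of \<Psi>, and
  differentiating them yields the Hessian. Its symmetry is needed because
  \<open>legendre_morphism\<close> puts its vector argument into the other slot.\<close>

lemma differential_has_derivative:
  assumes p: "p \<in> \<Theta>"
  shows "(differential \<Psi> has_derivative legendre_morphism \<Psi> p) (at p)"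
proof -
  have "((\<lambda>q. \<Sum>i\<in>Basis. frechet_derivative \<Psi> (at q) i *\<^sub>R blinfun_inner_left i) has_derivative
      (\<lambda>u. \<Sum>i\<in>Basis. hessian \<Psi> p u i *\<^sub>R blinfun_inner_left i)) (at p)"
    by (intro has_derivative_sum has_derivative_scaleR_left partial_has_derivative[OF p])
  moreover have "hessian \<Psi> p u i = legendre_morphism \<Psi> p u i" for u i
    by (simp add: legendre_apply[OF p] hessian_symmetric[OF p, of u])
  ultimately have "((\<lambda>q. \<Sum>i\<in>Basis. frechet_derivative \<Psi> (at q) i *\<^sub>R blinfun_inner_left i) has_derivative
      legendre_morphism \<Psi> p) (at p)"
    by (simp flip: blinfun_real_eq_sum)
  then show ?thesis
    by (rule has_derivative_transform_within_open[OF _ open_domain p])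
      (simp flip: differential_apply blinfun_real_eq_sum)
qed

lemmas frechet_derivative_differential =
  frechet_derivative_at[OF differential_has_derivative, symmetric]

text \<open>On the segment from \<open>p\<close> to \<open>q\<close>, the derivative of \<open>\<Psi>\<close> in the direction \<open>q - p\<close> is strictly
  increasing.\<close>

lemma inj_on_differential: "inj_on (differential \<Psi>) \<Theta>"
proof (rule inj_onI, rule ccontr)
  fix p q
  assume p: "p \<in> \<Theta>" and q: "q \<in> \<Theta>" and eq: "differential \<Psi> p = differential \<Psi> q" and ne: "p \<noteq> q"
  define c where "c t = p + t *\<^sub>R (q - p)" for t :: real
  define \<phi> where "\<phi> t = frechet_derivative \<Psi> (at (c t)) (q - p)" for t
  have c: "c t \<in> \<Theta>" if "0 \<le> t" "t \<le> 1" for t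
    using convexD_alt[OF convex_domain p q that] by (simp add: c_def algebra_simps)
  \<comment> \<open>By the chain rule the derivative along the segment is the Hessian on
    \<open>q - p\<close> twice.\<close>
  have "\<exists>y. (\<phi> has_real_derivative y) (at t) \<and> y > 0" if "0 \<le> t" "t \<le> 1" for t
  proof -
    note D = partial_has_derivative[OF c[OF that], of "q - p"]
    have "(c has_derivative (\<lambda>h. h *\<^sub>R (q - p))) (at t)"
      unfolding c_def by (auto intro!: derivative_eq_intros)
    from has_derivative_compose[OF this D]
    have "(\<phi> has_real_derivative hessian \<Psi> (c t) (q - p) (q - p)) (at t)"
      using linear_cmul[OF has_derivative_linear[OF D]]
      by (simp add: \<phi>_def[abs_def] has_field_derivative_def mult_commute_abs)
    moreover have "hessian \<Psi> (c t) (q - p) (q - p) > 0"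
      using pos_def c[OF that] ne by (simp add: pos_def_hessian_on_def)
    ultimately show ?thesis
      by blast
  qed
  then have "\<phi> 0 < \<phi> 1"
    by (rule DERIV_pos_imp_increasing[OF zero_less_one])
  moreover have "\<phi> 0 = differential \<Psi> p (q - p)" and "\<phi> 1 = differential \<Psi> q (q - p)"
    by (simp_all add: \<phi>_def c_def differential_apply p q)
  ultimately show False
    by (simp add: eq)
qed

lemma bounded_linear_legendre: "p \<in> \<Theta> \<Longrightarrow> bounded_linear (legendre_morphism \<Psi> p)"
  by (rule has_derivative_bounded_linear[OF differential_has_derivative])

text \<open>A vector \<open>Y\<close> in the kernel would satisfy g(Y,Y) = 0. Composing with
  \<open>dual_coords\<close> gives an endomorphism of a Euclidean space, for which injectivity
  implies surjectivity.\<close>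

lemma bij_dual_coords_legendre:
  assumes p: "p \<in> \<Theta>"
  shows "bij (\<lambda>Y. dual_coords (legendre_morphism \<Psi> p Y))"
proof -
  have lin: "linear (\<lambda>Y. dual_coords (legendre_morphism \<Psi> p Y))"
    by (intro bounded_linear.linear bounded_linear_compose[OF bounded_linear_dual_coords]
        bounded_linear_legendre[OF p])
  have "Y = 0" if "legendre_morphism \<Psi> p Y = 0" for Y
  proof (rule ccontr)
    assume "Y \<noteq> 0"
    then have "hessian \<Psi> p Y Y > 0"
      using pos_def p by (simp add: pos_def_hessian_on_def)
    with that legendre_apply[OF p, of Y Y] show False
      by simp
  qed
  then have "inj (legendre_morphism \<Psi> p)"
    using linear_injective_0[OF bounded_linear.linear[OF bounded_linear_legendre[OF p]]] by simp
  then have "inj (\<lambda>Y. dual_coords (legendre_morphism \<Psi> p Y))"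
    using inj_compose[OF inj_dual_coords] by (simp add: o_def)
  with lin show ?thesis
    by (simp add: bij_def linear_injective_imp_surjective)
qed

lemma bij_legendre:
  assumes p: "p \<in> \<Theta>"
  shows "bij (legendre_morphism \<Psi> p)"
proof (rule bijI)
  note bij = bij_dual_coords_legendre[OF p]
  show "inj (legendre_morphism \<Psi> p)"
    using bij_is_inj[OF bij] by (intro inj_on_imageI2[of dual_coords]) (simp only: o_def)
  show "surj (legendre_morphism \<Psi> p)"
  proof (rule surjI)
    fix \<alpha>
    \<comment> \<open>The preimage is found in coordinates; injectivity of
      \<open>dual_coords\<close> carries the equation back to covectors.\<close>
    show "legendre_morphism \<Psi> p (inv (\<lambda>Y. dual_coords (legendre_morphism \<Psi> p Y)) (dual_coords \<alpha>)) = \<alpha>"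
      by (rule injD[OF inj_dual_coords]) (rule surj_f_inv_f[OF bij_is_surj[OF bij]])
  qed
qed

text \<open>The inverse factors as \<open>inv ?M\<close> after \<open>dual_coords\<close>, and
  \<open>?M\<close> is an injective endomorphism of a Euclidean space.\<close>

lemma bounded_linear_inv_legendre:
  assumes p: "p \<in> \<Theta>"
  shows "bounded_linear (inv (legendre_morphism \<Psi> p))"
proof -
  let ?M = "\<lambda>Y. dual_coords (legendre_morphism \<Psi> p Y)"
  have "bounded_linear ?M"
    by (rule bounded_linear_compose[OF bounded_linear_dual_coords bounded_linear_legendre[OF p]])
  then have "bounded_linear (inv ?M)"
    using bij_is_inj[OF bij_dual_coords_legendre[OF p]] by (rule inj_linear_imp_inv_bounded_linear)
  then have "bounded_linear (\<lambda>\<alpha>. inv ?M (dual_coords \<alpha>))"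
    by (rule bounded_linear_compose[OF _ bounded_linear_dual_coords])
  moreover have "inv ?M (dual_coords \<alpha>) = inv (legendre_morphism \<Psi> p) \<alpha>" for \<alpha>
    by (metis bij_dual_coords_legendre[OF p] bij_legendre[OF p] bij_is_inj bij_is_surj inv_f_f surj_f_inv_f)
  ultimately show ?thesis
    by simp
qed

section \<open>The dual domain, the dual connection and flat charts\<close>

text \<open>Invariance of domain applies to d\<Psi> read in \<open>dual_coords\<close>. Since
  \<open>dual_coords\<close> is continuous and injective, the dual domain is the preimage of the
  open image, and the inverse of d\<Psi> is \<open>g\<close> after
  \<open>dual_coords\<close>.\<close>

lemma open_dual_domain: "open (differential \<Psi> ` \<Theta>)"
  and continuous_on_inv_differential:
    "continuous_on (differential \<Psi> ` \<Theta>) (the_inv_into \<Theta> (differential \<Psi>))"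
proof -
  let ?G = "\<lambda>p. dual_coords (differential \<Psi> p)"
  have "continuous_on \<Theta> (differential \<Psi>)"
    by (rule has_derivative_continuous_on[OF has_derivative_at_withinI[OF differential_has_derivative]])
  then have cont: "continuous_on \<Theta> ?G"
    by (rule bounded_linear.continuous_on[OF bounded_linear_dual_coords])
  have inj: "inj_on ?G \<Theta>"
    using inj_on_differential inj_dual_coords by (auto intro!: inj_onI dest: injD inj_onD)
  obtain g where g: "homeomorphism \<Theta> (?G ` \<Theta>) ?G g"
    using invariance_of_domain_homeomorphism[OF open_domain cont _ inj] by auto
  have "differential \<Psi> ` \<Theta> = dual_coords -` (?G ` \<Theta>)"
    using inj_dual_coords by (auto dest: injD)
  moreover have "open (?G ` \<Theta>)"
    using cont open_domain inj by (rule invariance_of_domain)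
  ultimately show "open (differential \<Psi> ` \<Theta>)"
    using open_vimage linear_continuous_on[OF bounded_linear_dual_coords] by metis
  have "continuous_on (differential \<Psi> ` \<Theta>) (\<lambda>\<alpha>. g (dual_coords \<alpha>))"
    by (rule continuous_on_compose2[OF homeomorphism_cont2[OF g]
          linear_continuous_on[OF bounded_linear_dual_coords]]) auto
  moreover have "g (dual_coords \<alpha>) = the_inv_into \<Theta> (differential \<Psi>) \<alpha>" if "\<alpha> \<in> differential \<Psi> ` \<Theta>" for \<alpha>
  proof -
    from that obtain p where p: "p \<in> \<Theta>" "\<alpha> = differential \<Psi> p"
      by blast
    then show ?thesis
      using homeomorphism_apply1[OF g p(1)] by (simp add: the_inv_into_f_f[OF inj_on_differential])
  qed
  ultimately show "continuous_on (differential \<Psi> ` \<Theta>) (the_inv_into \<Theta> (differential \<Psi>))"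
    by (simp cong: continuous_on_cong)
qed

text \<open>A continuous inverse between open sets is differentiable wherever the derivative of the
  map has a bounded inverse.\<close>

lemma inv_differential_has_derivative:
  assumes p: "p \<in> \<Theta>"
  shows "(the_inv_into \<Theta> (differential \<Psi>) has_derivative inv (legendre_morphism \<Psi> p))
    (at (differential \<Psi> p))"
proof (rule has_derivative_inverse_dieudonne[OF open_domain open_dual_domain _
      continuous_on_inv_differential _ p differential_has_derivative[OF p] bounded_linear_inv_legendre[OF p]])
  show "continuous_on \<Theta> (differential \<Psi>)"
    by (rule has_derivative_continuous_on[OF has_derivative_at_withinI[OF differential_has_derivative]])
  show "inv (legendre_morphism \<Psi> p) \<circ> legendre_morphism \<Psi> p = id"
    by (rule inv_o_cancel[OF bij_is_inj[OF bij_legendre[OF p]]])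
qed (rule the_inv_into_f_f[OF inj_on_differential])

text \<open>In the coordinates of \<open>\<Theta>\<^sup>*\<close>, the vector field corresponding to a covector field \<open>s\<close> via the metric
  is \<open>s\<close> itself, so \<open>\<nabla>\<^sup>-\<close> is componentwise differentiation of covector fields.\<close>

lemma dual_connection_eq:
  assumes p: "p \<in> \<Theta>" and s: "(s has_derivative s') (at p)"
  shows "dual_connection \<Theta> \<Psi> Z s p = s' (Z p)"
proof -
  let ?F = "differential \<Psi>" and ?L = "legendre_morphism \<Psi>"
  let ?Y = "\<lambda>q. inv (?L q) (s q)"
  \<comment> \<open>Pushing forward along d\<Psi> applies its derivative, which is the Legendre
    morphism.\<close>
  have push: "pushforward_field \<Theta> ?F X (?F q) = ?L q (X q)" if "q \<in> \<Theta>" for X q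
    using that
    by (simp add: pushforward_field_def the_inv_into_f_f[OF inj_on_differential]
        frechet_derivative_differential)
  have Y: "?L q (?Y q) = s q" if "q \<in> \<Theta>" for q
    using surj_f_inv_f[OF bij_is_surj[OF bij_legendre[OF that]]] .
  \<comment> \<open>By \<open>push\<close> and \<open>Y\<close>, the pushed field is
    \<open>s\<close> composed with the inverse of d\<Psi>. The inverse Legendre morphism in its
    derivative then cancels against the one from pushing \<open>Z\<close>.\<close>
  have "((\<lambda>\<alpha>. s (the_inv_into \<Theta> ?F \<alpha>)) has_derivative (\<lambda>h. s' (inv (?L p) h))) (at (?F p))"
    using has_derivative_compose[OF inv_differential_has_derivative[OF p]] s
    by (simp add: the_inv_into_f_f[OF inj_on_differential p])
  then have "(pushforward_field \<Theta> ?F ?Y has_derivative (\<lambda>h. s' (inv (?L p) h))) (at (?F p))"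
    by (rule has_derivative_transform_within_open[OF _ open_dual_domain])
      (use p push Y in \<open>auto simp: the_inv_into_f_f[OF inj_on_differential]\<close>)
  from frechet_derivative_at[OF this]
  have "affine_connection (pushforward_field \<Theta> ?F Z) (pushforward_field \<Theta> ?F ?Y) (?F p) =
      s' (inv (?L p) (?L p (Z p)))"
    by (simp add: affine_connection_def push[OF p] fun_eq_iff)
  also have "\<dots> = s' (Z p)"
    by (simp add: inv_f_f[OF bij_is_inj[OF bij_legendre[OF p]]])
  finally have "?L p (pullback_affine_connection \<Theta> ?F Z ?Y p) = s' (Z p)"
    by (simp add: pullback_affine_connection_def pullback_field_def frechet_derivative_differential[OF p]
        surj_f_inv_f[OF bij_is_surj[OF bij_legendre[OF p]]])
  then show ?thesis
    by (simp add: dual_connection_def transport_connection_def tangent_bundle_def)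
qed

text \<open>Flat charts are locally affine: the inverse of such a chart has vanishing second derivative, so
  that the Hessian transforms as a bilinear form.\<close>

lemma pos_def_hessian_in_flat_chart:
  assumes "flat_chart \<Theta> affine_connection U x"
  shows "pos_def_hessian_on (x ` U) (\<Psi> \<circ> the_inv_into U x)"
  unfolding pos_def_hessian_on_def
proof (intro ballI allI impI)
  fix y v :: 'a
  assume "y \<in> x ` U" and v: "v \<noteq> 0"
  then obtain p where p: "p \<in> U" and y: "y = x p"
    by blast
  define \<kappa> where "\<kappa> = the_inv_into U x"
  \<comment> \<open>The field on \<open>U\<close> whose components in the chart are constantly those
    of \<open>v\<close>.\<close>
  define Z where "Z q = frechet_derivative \<kappa> (at (x q)) v" for q
  have U: "U \<subseteq> \<Theta>" "open U" "open (x ` U)" and inj: "inj_on x U" and x: "smooth_on U x"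
    and \<kappa>: "smooth_on (x ` U) \<kappa>"
    and flat: "\<And>i Z p. i \<in> Basis \<Longrightarrow> vector_field U Z \<Longrightarrow> p \<in> U \<Longrightarrow>
      affine_connection Z (pullback_field x (\<lambda>_. i)) p = 0"
    using assms by (auto simp: flat_chart_def diffeo_onto_open_def \<kappa>_def)
  have p\<Theta>: "p \<in> \<Theta>"
    using p U(1) by blast
  have \<kappa>_x [simp]: "\<kappa> (x q) = q" if "q \<in> U" for q
    unfolding \<kappa>_def by (rule the_inv_into_f_f[OF inj that])
  have \<kappa>_der: "(\<kappa> has_derivative frechet_derivative \<kappa> (at (x q))) (at (x q))" if "q \<in> U" for q
    using that by (intro smooth_on_has_derivative[OF \<kappa>]) blast
  \<comment> \<open>Obtained by differentiating the two identities that make \<kappa> and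
    \<open>x\<close> mutually inverse.\<close>
  have inverse: "frechet_derivative x (at q) (frechet_derivative \<kappa> (at (x q)) w) = w"
    "frechet_derivative \<kappa> (at (x q)) (frechet_derivative x (at q) w) = w" if q: "q \<in> U" for q w
  proof -
    note x_der = smooth_on_has_derivative[OF x q]
    have "((\<lambda>q. \<kappa> (x q)) has_derivative
        (\<lambda>w. frechet_derivative \<kappa> (at (x q)) (frechet_derivative x (at q) w))) (at q)"
      by (rule has_derivative_compose[OF x_der \<kappa>_der[OF q]])
    then have "((\<lambda>q. q) has_derivative
        (\<lambda>w. frechet_derivative \<kappa> (at (x q)) (frechet_derivative x (at q) w))) (at q)"
      by (rule has_derivative_transform_within_open[OF _ U(2) q]) simp
    from has_derivative_unique[OF this has_derivative_ident]
    show "frechet_derivative \<kappa> (at (x q)) (frechet_derivative x (at q) w) = w"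
      by (rule fun_cong)
    have "((\<lambda>z. x (\<kappa> z)) has_derivative
        (\<lambda>w. frechet_derivative x (at q) (frechet_derivative \<kappa> (at (x q)) w))) (at (x q))"
      using has_derivative_compose[OF \<kappa>_der[OF q], of x "frechet_derivative x (at q)"] x_der q by simp
    then have "((\<lambda>z. z) has_derivative
        (\<lambda>w. frechet_derivative x (at q) (frechet_derivative \<kappa> (at (x q)) w))) (at (x q))"
      by (rule has_derivative_transform_within_open[OF _ U(3)]) (use q in auto)
    from has_derivative_unique[OF this has_derivative_ident]
    show "frechet_derivative x (at q) (frechet_derivative \<kappa> (at (x q)) w) = w"
      by (rule fun_cong)
  qed
  have frame: "pullback_field x (\<lambda>_. i) q = frechet_derivative \<kappa> (at (x q)) i" if "q \<in> U" for i q
    unfolding pullback_field_def using inverse[OF that] by (intro inv_f_eq) (metis injI)+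
  \<comment> \<open>Flatness, tested against the constant fields \<open>w\<close>, makes every
    directional derivative of a coordinate field vanish.\<close>
  have frame_const: "((\<lambda>q. frechet_derivative \<kappa> (at (x q)) i) has_derivative (\<lambda>_. 0)) (at p)"
    if i: "i \<in> Basis" for i
  proof -
    have "((\<lambda>z. frechet_derivative \<kappa> (at z) i) has_derivative
        frechet_derivative (\<lambda>z. frechet_derivative \<kappa> (at z) i) (at (x p))) (at (x p))"
      using p by (intro smooth_on_has_derivative[OF smooth_on_directional[OF \<kappa>]]) blast
    from has_derivative_compose[OF smooth_on_has_derivative[OF x p] this]
    obtain d where d: "((\<lambda>q. frechet_derivative \<kappa> (at (x q)) i) has_derivative d) (at p)"
      by blast
    then have "(pullback_field x (\<lambda>_. i) has_derivative d) (at p)"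
      by (rule has_derivative_transform_within_open[OF _ U(2) p]) (simp add: frame)
    then have "d w = affine_connection (\<lambda>_. w) (pullback_field x (\<lambda>_. i)) p" for w
      by (simp add: affine_connection_def flip: frechet_derivative_at)
    then have "d = (\<lambda>_. 0)"
      using flat[OF i, of _ p] p
      by (simp add: fun_eq_iff smooth_section_def tangent_bundle_def smooth_on_const)
    with d show ?thesis
      by simp
  qed
  have "((\<lambda>q. \<Sum>i\<in>Basis. (v \<bullet> i) *\<^sub>R frechet_derivative \<kappa> (at (x q)) i) has_derivative
      (\<lambda>_. \<Sum>i\<in>Basis. (v \<bullet> i) *\<^sub>R 0)) (at p)"
    by (intro has_derivative_sum has_derivative_scaleR_right frame_const)
  then have "(Z has_derivative (\<lambda>_. 0)) (at p)"
    unfolding Z_def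
    by (rule has_derivative_eq_rhs[OF has_derivative_transform_within_open[OF _ U(2) p]])
      (simp_all flip: linear_sum_Basis[OF has_derivative_linear[OF \<kappa>_der]])
  \<comment> \<open>As \<open>Z\<close> has zero derivative at \<open>p\<close>, the first-order
    term of the product rule disappears and only the Hessian of \<Psi> remains.\<close>
  from derivative_along_has_derivative[OF smooth this open_domain p\<Theta>]
  have along: "((\<lambda>q. frechet_derivative \<Psi> (at q) (Z q)) has_derivative (\<lambda>h. hessian \<Psi> p h (Z p))) (at p)"
    using linear_0[OF has_derivative_linear[OF smooth_on_has_derivative[OF smooth p\<Theta>]]]
    by (simp add: hessian_def)
  have "((\<lambda>z. frechet_derivative \<Psi> (at (\<kappa> z)) (Z (\<kappa> z))) has_derivative
      (\<lambda>h. hessian \<Psi> p (frechet_derivative \<kappa> (at (x p)) h) (Z p))) (at (x p))"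
    using has_derivative_compose[OF \<kappa>_der[OF p],
        of "\<lambda>q. frechet_derivative \<Psi> (at q) (Z q)", unfolded \<kappa>_x[OF p], OF along] .
  moreover have "frechet_derivative (\<Psi> \<circ> \<kappa>) (at (x q)) v = frechet_derivative \<Psi> (at q) (Z q)"
    if q: "q \<in> U" for q
  proof -
    have "((\<lambda>z. \<Psi> (\<kappa> z)) has_derivative
        (\<lambda>h. frechet_derivative \<Psi> (at q) (frechet_derivative \<kappa> (at (x q)) h))) (at (x q))"
      using has_derivative_compose[OF \<kappa>_der[OF q], of \<Psi>, unfolded \<kappa>_x[OF q],
          OF smooth_on_has_derivative[OF smooth]] q U(1) by blast
    from fun_cong[OF frechet_derivative_at[OF this], of v] show ?thesis
      by (simp add: Z_def o_def)
  qed
  ultimately have "((\<lambda>z. frechet_derivative (\<Psi> \<circ> \<kappa>) (at z) v) has_derivative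
      (\<lambda>h. hessian \<Psi> p (frechet_derivative \<kappa> (at (x p)) h) (Z p))) (at (x p))"
    using p by (elim has_derivative_transform_within_open[OF _ U(3)]) auto
  from fun_cong[OF frechet_derivative_at[OF this], of v]
  have "hessian (\<Psi> \<circ> \<kappa>) y v v = hessian \<Psi> p (Z p) (Z p)"
    by (simp add: hessian_def[of "\<Psi> \<circ> \<kappa>"] y Z_def)
  moreover have "Z p \<noteq> 0"
    using inverse(1)[OF p, of v] v linear_0[OF has_derivative_linear[OF smooth_on_has_derivative[OF x p]]]
    by (auto simp: Z_def)
  ultimately show "hessian (\<Psi> \<circ> the_inv_into U x) y v v > 0"
    using pos_def p U by (auto simp: pos_def_hessian_on_def \<kappa>_def subset_iff)
qed

end

section \<open>The canonical Legendre bundle of a potential\<close>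

lemma inv_ident: "inv (\<lambda>x. x) = (\<lambda>x. x)"
  by (rule inv_id[unfolded id_def])

lemma transport_connection_ident [simp]:
  "transport_connection tangent_bundle (\<lambda>_ X. X) D = D"
  by (simp add: transport_connection_def tangent_bundle_def fun_eq_iff inv_ident)

text \<open>The coordinate fields of the identity chart are constant, hence parallel for
  \<open>affine_connection\<close>.\<close>

lemma flat_chart_ident:
  assumes "open B"
  shows "flat_chart B affine_connection B (\<lambda>x. x)"
proof -
  have "smooth_on B (the_inv_into B (\<lambda>x. x))"
    by (subst smooth_on_cong[OF assms, of _ "\<lambda>x. x"])
      (auto simp: the_inv_into_f_f[of "\<lambda>x. x" B, simplified] smooth_on_id)
  then show ?thesis
    using assms
    by (simp add: flat_chart_def diffeo_onto_open_def smooth_on_id pullback_field_def[abs_def]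
        affine_connection_def inv_ident)
qed

lemma bundle_iso_ident: "bundle_iso B E E (\<lambda>_ x. x)"
  by (simp add: bundle_iso_def bij_betw_def)

lemma (in convex_potential) legendre_bundle_canonical:
  "legendre_bundle \<Theta> tangent_bundle (\<lambda>_ X. X) cotangent_bundle (\<lambda>_ \<alpha>. \<alpha>) canonical_pairing
    affine_connection (dual_connection \<Theta> \<Psi>) \<Psi>"
proof
  note open_domain [simp]
  \<comment> \<open>On smooth covector fields \<nabla>^- is the directional derivative, which is all
    that flatness and duality require of it.\<close>
  have dual: "dual_connection \<Theta> \<Psi> Z s p = frechet_derivative s (at p) (Z p)"
    if "U \<subseteq> \<Theta>" "smooth_on U s" "p \<in> U" for U Z s p
    using that by (intro dual_connection_eq smooth_on_has_derivative) auto
  show "open \<Theta>"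
    by simp
  show "vector_bundle \<Theta> tangent_bundle" "vector_bundle \<Theta> cotangent_bundle"
    by (simp_all add: vector_bundle_tangent vector_bundle_cotangent)
  show "bundle_iso \<Theta> tangent_bundle tangent_bundle (\<lambda>_ X. X)"
    "bundle_iso \<Theta> cotangent_bundle cotangent_bundle (\<lambda>_ \<alpha>. \<alpha>)"
    by (rule bundle_iso_ident)+
  show "flat_connection \<Theta> tangent_bundle affine_connection"
    by (rule flat_connection_directional) (simp_all add: affine_connection_def tangent_bundle_def)
  show "flat_connection \<Theta> cotangent_bundle (dual_connection \<Theta> \<Psi>)"
    by (rule flat_connection_directional) (simp_all add: dual cotangent_bundle_def)
  show "torsion_free \<Theta> (transport_connection tangent_bundle (\<lambda>_ X. X) affine_connection)"
    by (simp add: torsion_free_def affine_connection_def lie_bracket_def)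
  show "smooth_on \<Theta> \<Psi>"
    by (rule smooth)
  show "\<exists>U x. p \<in> U \<and> flat_chart \<Theta> (transport_connection tangent_bundle (\<lambda>_ X. X) affine_connection) U x"
    if "p \<in> \<Theta>" for p
    using that flat_chart_ident[OF open_domain] by auto
  show "pos_def_hessian_on (x ` U) (\<Psi> \<circ> the_inv_into U x)"
    if "flat_chart \<Theta> (transport_connection tangent_bundle (\<lambda>_ X. X) affine_connection) U x" for U x
    using that by (simp add: pos_def_hessian_in_flat_chart)
  show "canonical_pairing p u v = canonical_pairing p v u" for p :: 'a and u v
    by (simp add: canonical_pairing_def)
  show "canonical_pairing p (u + u') v = canonical_pairing p u v + canonical_pairing p u' v"
    for p :: 'a and u u' v
    by (simp add: canonical_pairing_def blinfun.bilinear_simps)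
  show "canonical_pairing p (c *\<^sub>R u) v = c * canonical_pairing p u v" for p :: 'a and c u v
    by (simp add: canonical_pairing_def blinfun.bilinear_simps distrib_left)
  show "canonical_pairing p (x, 0) (y, 0) = 0" for p x y :: 'a
    by (simp add: canonical_pairing_def)
  show "canonical_pairing p (0, a) (0, b) = 0" for p :: 'a and a b
    by (simp add: canonical_pairing_def)
  show "canonical_pairing p (x, 0) (0, a) = a x" for p x :: 'a and a
    by (simp add: canonical_pairing_def)
  show "u = 0" if "\<forall>v \<in> tangent_bundle p \<times> cotangent_bundle p. canonical_pairing p u v = 0" for p :: 'a and u
  proof -
    \<comment> \<open>Testing against vectors kills the covector part of \<open>u\<close>; testing
      against the covector dual to \<open>fst u\<close> gives its squared norm.\<close>
    have "snd u y = 0" for y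
      using that[rule_format, of "(y, 0)"] by (simp add: canonical_pairing_def tangent_bundle_def cotangent_bundle_def)
    moreover have "fst u \<bullet> fst u = 0"
      using that[rule_format, of "(0, blinfun_inner_left (fst u))"]
      by (simp add: canonical_pairing_def tangent_bundle_def cotangent_bundle_def)
    ultimately show ?thesis
      by (auto intro!: prod_eqI blinfun_eqI)
  qed
  show "smooth_on U (\<lambda>p. canonical_pairing p (s p) (t p))"
    if "open U" "smooth_section U (\<lambda>p. tangent_bundle p \<times> cotangent_bundle p) s"
      "smooth_section U (\<lambda>p. tangent_bundle p \<times> cotangent_bundle p) t" for U s t
    using that unfolding canonical_pairing_def
    by (intro smooth_on_add smooth_on_bilinear[OF bounded_bilinear_blinfun_apply]
        smooth_on_bounded_linear[OF bounded_linear_fst] smooth_on_bounded_linear[OF bounded_linear_snd])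
      (auto simp: smooth_section_def)
  show "frechet_derivative (\<lambda>q. canonical_pairing q (X q, 0) (0, \<alpha> q)) (at p) (Z p) =
      canonical_pairing p (affine_connection Z X p, 0) (0, \<alpha> p) +
      canonical_pairing p (X p, 0) (0, dual_connection \<Theta> \<Psi> Z \<alpha> p)"
    if "U \<subseteq> \<Theta>" "smooth_section U tangent_bundle X" "smooth_section U cotangent_bundle \<alpha>" "p \<in> U"
    for U Z X \<alpha> p
  proof -
    have X: "smooth_on U X" and \<alpha>: "smooth_on U \<alpha>"
      using that by (auto simp: smooth_section_def)
    \<comment> \<open>Duality is the product rule for the evaluation of covectors on
      vectors.\<close>
    note der = bounded_bilinear.FDERIV[OF bounded_bilinear_blinfun_apply
        smooth_on_has_derivative[OF \<alpha> that(4)] smooth_on_has_derivative[OF X that(4)]]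
    show ?thesis
      by (simp add: canonical_pairing_def affine_connection_def dual[OF that(1) \<alpha> that(4)]
          flip: frechet_derivative_at[OF der])
  qed
qed

theorem proposition2:
  fixes \<mu> :: "'w measure"
    and T :: "'w \<Rightarrow> real ^ 'n"
    and P :: "real ^ 'n \<Rightarrow> 'w measure"
    and \<Theta> :: "(real ^ 'n) set"
    and \<Psi> :: "real ^ 'n \<Rightarrow> real"
  assumes "exponential_family \<mu> T P"
    and "\<Theta> = natural_parameter_space \<mu> T"
    and "\<Psi> = log_partition \<mu> T"
  shows "legendre_bundle \<Theta>
           tangent_bundle (\<lambda>_ X. X)
           cotangent_bundle (\<lambda>_ \<alpha>. \<alpha>)
           canonical_pairing
           affine_connection
           (dual_connection \<Theta> \<Psi>)
           \<Psi>"
proof -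
  interpret exponential_family \<mu> T P
    by (rule assms(1))
  interpret convex_potential \<Theta> \<Psi>
    unfolding assms(2,3)
    using open_parameters convex_parameters smooth_log_partition pos_def_log_partition
    by unfold_locales
  show ?thesis
    by (rule legendre_bundle_canonical)
qed

end
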